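(* Let $u\in L_\infty(\mu)$ be such that the multiplication operator $M_u f=u\cdot f$ is well defined on $L(p,q)$. If $u\neq 0$ (i.e. it is not the case that $u=0$ $\mu$-almost everywhere on $X$), then the ascent $\alpha(M_u)$ is either $0$ or $1$.
   Context: $(X,\mathcal A,\mu)$ is a $\sigma$-finite complete measure space. For measurable $h:X\to\mathbb C$ put $\mu_h(s)=\mu(\{x\in X:|h(x)|>s\})$ for $s\ge 0$, $h^*(t)=\inf\{s>0:\mu_h(s)\le t\}$ and $h^{**}(t)=\frac1t\int_0^t h^*(s)\,ds$ for $t>0$. The Lorentz space $L(p,q)$ (for $1<p<\infty$, $1\le q<\infty$, or $1<p\le\infty$, $q=\infty$) is the Banach space of (a.e.-equivalence classes of) measurable $h:X\to\mathbb C$ with $\|h\|_{pq}<\infty$, where $\|h\|_{pq}=\left(\frac qp\int_0^\infty (t^{1/p}h^{**}(t))^q\frac{dt}{t}\right)^{1/q}$ if $1<p<\infty$, $1\le q<\infty$, and $\|h\|_{pq}=\sup_{t>0}t^{1/p}h^{**}(t)$ if $1<p\le\infty$, $q=\infty$. For a bounded linear operator $L$ with null space $\mathcal N(L)$, the ascent is $\alpha(L)=\inf\{k\in\mathbb N\cup\{0\}:\mathcal N(L^{k+1})=\mathcal N(L^k)\}$ (equal to $\infty$ if no such $k$ exists), with $L^0=I$. *)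

theory Defs
  imports "HOL-Analysis.Analysis" "HOL-Library.Extended_Nat"
begin

definition distribution_fun :: "'a measure \<Rightarrow> ('a \<Rightarrow> complex) \<Rightarrow> real \<Rightarrow> ennreal" where
  "distribution_fun M h s = emeasure M {x \<in> space M. norm (h x) > s}"

(* The infimum of the empty set is infinity, so the rearrangement is ennreal-valued. *)
definition rearrangement :: "'a measure \<Rightarrow> ('a \<Rightarrow> complex) \<Rightarrow> real \<Rightarrow> ennreal" where
  "rearrangement M h t = (INF s \<in> {s. s > 0 \<and> distribution_fun M h s \<le> ennreal t}. ennreal s)"

definition avg_rearrangement :: "'a measure \<Rightarrow> ('a \<Rightarrow> complex) \<Rightarrow> real \<Rightarrow> ennreal" where
  "avg_rearrangement M h t = ennreal (1 / t) * (\<integral>\<^sup>+s\<in>{0<..<t}. rearrangement M h s \<partial>lborel)"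

(* Real powers of extended nonnegative reals; only used with exponents a > 0. *)
definition ennpowr :: "ennreal \<Rightarrow> real \<Rightarrow> ennreal" where
  "ennpowr x a = (if x = \<infinity> then \<infinity> else ennreal (enn2real x powr a))"

definition lorentz_index :: "ennreal \<Rightarrow> ennreal \<Rightarrow> bool" where
  "lorentz_index p q \<longleftrightarrow> (1 < p \<and> p < \<infinity> \<and> 1 \<le> q \<and> q < \<infinity>) \<or> (1 < p \<and> q = \<infinity>)"

(* For p = \<infinity> the exponent enn2real (1 / p) is 0. *)
definition lorentz_norm :: "'a measure \<Rightarrow> ennreal \<Rightarrow> ennreal \<Rightarrow> ('a \<Rightarrow> complex) \<Rightarrow> ennreal" where
  "lorentz_norm M p q h =
    (if q = \<infinity>
     then (SUP t \<in> {0<..}. ennreal (t powr enn2real (1 / p)) * avg_rearrangement M h t)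
     else ennpowr
       (q / p * (\<integral>\<^sup>+t\<in>{0<..}.
          (ennpowr (ennreal (t powr enn2real (1 / p)) * avg_rearrangement M h t) (enn2real q)
            * ennreal (1 / t)) \<partial>lborel))
       (1 / enn2real q))"

definition ae_rel :: "'a measure \<Rightarrow> (('a \<Rightarrow> complex) \<times> ('a \<Rightarrow> complex)) set" where
  "ae_rel M = {(f, g). f \<in> borel_measurable M \<and> g \<in> borel_measurable M \<and> (AE x in M. f x = g x)}"

definition ae_class :: "'a measure \<Rightarrow> ('a \<Rightarrow> complex) \<Rightarrow> ('a \<Rightarrow> complex) set" where
  "ae_class M f = ae_rel M `` {f}"

definition lorentz_space :: "'a measure \<Rightarrow> ennreal \<Rightarrow> ennreal \<Rightarrow> ('a \<Rightarrow> complex) set set" where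
  "lorentz_space M p q = {f \<in> borel_measurable M. lorentz_norm M p q f < \<infinity>} // ae_rel M"

definition Linfty :: "'a measure \<Rightarrow> ('a \<Rightarrow> complex) set" where
  "Linfty M = {u \<in> borel_measurable M. \<exists>C. AE x in M. norm (u x) \<le> C}"

(* The operator acts on classes; the union is over all representatives f of the class F,
   and for measurable u each of them contributes the same class. *)
definition mult_op :: "'a measure \<Rightarrow> ('a \<Rightarrow> complex) \<Rightarrow> ('a \<Rightarrow> complex) set \<Rightarrow> ('a \<Rightarrow> complex) set" where
  "mult_op M u F = (\<Union>f\<in>F. ae_class M (\<lambda>x. u x * f x))"

(* Null space and ascent of an operator L on a space with carrier V and zero vector z. *)
definition null_space :: "'v set \<Rightarrow> 'v \<Rightarrow> ('v \<Rightarrow> 'v) \<Rightarrow> 'v set" where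
  "null_space V z L = {v \<in> V. L v = z}"

definition ascent :: "'v set \<Rightarrow> 'v \<Rightarrow> ('v \<Rightarrow> 'v) \<Rightarrow> enat" where
  "ascent V z L = Inf {enat k | k. null_space V z (L ^^ (k + 1)) = null_space V z (L ^^ k)}"

lemma equiv_ae_rel: "equiv (borel_measurable M) (ae_rel M)"
  by (auto simp: equiv_def refl_on_def sym_def trans_def ae_rel_def)

lemma mult_op_ae_class:
  assumes u: "u \<in> borel_measurable M" and f: "f \<in> borel_measurable M"
  shows "mult_op M u (ae_class M f) = ae_class M (\<lambda>x. u x * f x)"
proof -
  have same: "ae_class M (\<lambda>x. u x * g x) = ae_class M (\<lambda>x. u x * f x)"
    if "g \<in> ae_class M f" for g
  proof -
    have "((\<lambda>x. u x * f x), (\<lambda>x. u x * g x)) \<in> ae_rel M"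
      using that u by (auto simp: ae_class_def ae_rel_def)
    then show ?thesis
      unfolding ae_class_def using equiv_class_eq[OF equiv_ae_rel] by blast
  qed
  have "f \<in> ae_class M f"
    using f by (simp add: ae_class_def ae_rel_def)
  then show ?thesis
    unfolding mult_op_def using same by blast
qed

lemma lorentz_norm_ae_cong:
  assumes "(f, g) \<in> ae_rel M"
  shows "lorentz_norm M p q f = lorentz_norm M p q g"
proof -
  have "distribution_fun M f = distribution_fun M g"
  proof
    fix s
    have [measurable]: "f \<in> borel_measurable M" "g \<in> borel_measurable M"
      and "AE x in M. f x = g x"
      using assms by (auto simp: ae_rel_def)
    then show "distribution_fun M f s = distribution_fun M g s"
      unfolding distribution_fun_def by (intro emeasure_eq_AE) auto
  qed
  then show ?thesis
    by (simp add: lorentz_norm_def avg_rearrangement_def rearrangement_def)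
qed

end

theory Submission
  imports Defs
begin

text \<open>On the class of f, the k-th power of the operator is multiplication by u^k
  (\<open>mult_op_funpow_ae_class\<close>). Since the complex numbers have no zero divisors, for k >
  0 the product u^k f vanishes almost everywhere exactly when u f does
  (\<open>mult_op_funpow_eq_zero_iff\<close>). Hence all positive powers share one null space
  (\<open>null_space_mult_op_funpow\<close>), the chain of null spaces is constant from index 1 on,
  and the ascent is at most 1.\<close>

lemma ae_class_eq_iff:
  assumes "f \<in> borel_measurable M" "g \<in> borel_measurable M"
  shows "ae_class M f = ae_class M g \<longleftrightarrow> (AE x in M. f x = g x)"
  using eq_equiv_class_iff[OF equiv_ae_rel assms] assms
  by (simp add: ae_class_def ae_rel_def)

lemma lorentz_spaceE:
  assumes "F \<in> lorentz_space M p q"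
  obtains f where "f \<in> borel_measurable M" "F = ae_class M f"
  using assms by (auto simp: lorentz_space_def ae_class_def elim!: quotientE)

lemma mult_op_funpow_ae_class:
  assumes [measurable]: "u \<in> borel_measurable M" "f \<in> borel_measurable M"
  shows "(mult_op M u ^^ k) (ae_class M f) = ae_class M (\<lambda>x. u x ^ k * f x)"
  by (induction k) (simp_all add: mult_op_ae_class mult.assoc)

text \<open>For k > 0 the functions u^k and u have the same zeros, so the right-hand side does not
  mention k. For k = 0 this fails, as u^0 = 1.\<close>

lemma mult_op_funpow_eq_zero_iff:
  assumes [measurable]: "u \<in> borel_measurable M" "f \<in> borel_measurable M"
    and "k > 0"
  shows "(mult_op M u ^^ k) (ae_class M f) = ae_class M (\<lambda>x. 0) \<longleftrightarrow>
         (AE x in M. u x = 0 \<or> f x = 0)"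
  using \<open>k > 0\<close> by (simp add: mult_op_funpow_ae_class ae_class_eq_iff)

lemma null_space_mult_op_funpow:
  assumes "u \<in> borel_measurable M" "k > 0" "l > 0"
  shows "null_space (lorentz_space M p q) (ae_class M (\<lambda>x. 0)) (mult_op M u ^^ k) =
         null_space (lorentz_space M p q) (ae_class M (\<lambda>x. 0)) (mult_op M u ^^ l)"
proof -
  have "(mult_op M u ^^ k) F = ae_class M (\<lambda>x. 0) \<longleftrightarrow> (mult_op M u ^^ l) F = ae_class M (\<lambda>x. 0)"
    if "F \<in> lorentz_space M p q" for F
    using that assms by (elim lorentz_spaceE) (simp add: mult_op_funpow_eq_zero_iff)
  then show ?thesis
    unfolding null_space_def by blast
qed

lemma ascent_le:
  assumes "null_space V z (L ^^ (k + 1)) = null_space V z (L ^^ k)"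
  shows "ascent V z L \<le> enat k"
  unfolding ascent_def using assms by (blast intro: Inf_lower)

theorem theorem3p1:
  fixes M :: "'a measure" and p q :: ennreal and u :: "'a \<Rightarrow> complex"
  assumes "sigma_finite_measure M" and "complete_measure M"
    and "lorentz_index p q"
    and "u \<in> Linfty M"
    and "mult_op M u ` lorentz_space M p q \<subseteq> lorentz_space M p q"
    and "\<not> (AE x in M. u x = 0)"
  shows "ascent (lorentz_space M p q) (ae_class M (\<lambda>x. 0)) (mult_op M u) = 0 \<or>
         ascent (lorentz_space M p q) (ae_class M (\<lambda>x. 0)) (mult_op M u) = 1"
proof -
  let ?a = "ascent (lorentz_space M p q) (ae_class M (\<lambda>x. 0)) (mult_op M u)"
  have "u \<in> borel_measurable M"
    using \<open>u \<in> Linfty M\<close> by (simp add: Linfty_def)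
  \<comment> \<open>Stabilization at k = 1 compares the powers 2 and 1, both positive. Power 0 is
    the identity, which is why the bound is 1 and not 0.\<close>
  then have "?a \<le> enat 1"
    by (intro ascent_le null_space_mult_op_funpow) auto
  then show ?thesis
    by (cases ?a) (auto simp: zero_enat_def one_enat_def)
qed

end
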